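(* Let $k\ge2$, $a>0$ and $D\ge1$, and suppose that for each $n$, $\mathcal{H}=\mathcal{H}_n$ is a $k$-uniform hypergraph satisfying $v(\mathcal{H})\le Dn$, $e(\mathcal{H})\ge an^2$ and $\Delta_2(\mathcal{H})\le D$. Let $X=e(\mathcal{H}_p)$, $\mu=\mathbb{E}X$ and $\Lambda=\mu(1+np^{k-1})$. Given $\alpha\in(0,1)$, there are $n_0>0$ (depending only on $k,a,D$) and $c,\lambda\ge1$ (depending only on $\alpha,k,a,D$) such that for all $n\ge n_0$, $p\in(0,1-\alpha]$ and $t\ge\mathbf{1}\{\mu\ge1/2\}\min\{\sqrt{\mathrm{Var}\,X},\sqrt{\Lambda}\}$ satisfying $\mathfrak{X}(\mathcal{H},D,\min\{\lambda t,\mu+t\})$ and $\mu+t\ge1$ we have \[ \Pr(X\ge\mu+t)\ge\exp\bigl(-c\sqrt{t}\log(1/p)\bigr). \]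
   Context: $V_p(\mathcal{H})$ is the random subset of $V(\mathcal{H})$ containing each vertex independently with probability $p$, and $\mathcal{H}_p=\mathcal{H}[V_p(\mathcal{H})]$. $\Delta_2(\mathcal{H})$ is the maximum number of edges containing a given pair of vertices. The property $\mathfrak{X}(\mathcal{H},D,x)$ means: there exists $W\subseteq V(\mathcal{H})$ with $|W|\le D\max\{\sqrt{x},1\}$ and $e(\mathcal{H}[W])\ge x$. $\mathbf{1}\{\cdot\}$ is the indicator. *)

theory Defs
  imports "HOL-Probability.Probability"
begin

record 'v hypergraph =
  verts :: "'v set"
  edges :: "'v set set"

definition num_verts :: "'v hypergraph \<Rightarrow> nat" where
  "num_verts H = card (verts H)"

definition num_edges :: "'v hypergraph \<Rightarrow> nat" where
  "num_edges H = card (edges H)"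

definition uniform_hypergraph :: "nat \<Rightarrow> 'v hypergraph \<Rightarrow> bool" where
  "uniform_hypergraph k H \<longleftrightarrow>
     finite (verts H) \<and> (\<forall>e\<in>edges H. e \<subseteq> verts H \<and> card e = k)"

definition induced :: "'v hypergraph \<Rightarrow> 'v set \<Rightarrow> 'v hypergraph" where
  "induced H W = \<lparr>verts = verts H \<inter> W, edges = {e \<in> edges H. e \<subseteq> W}\<rparr>"

(* Inserting 0 only gives the maximum a value for hypergraphs with fewer than two vertices. *)
definition max_pair_degree :: "'v hypergraph \<Rightarrow> nat" where
  "max_pair_degree H =
     Max (insert 0 {card {e \<in> edges H. {u, v} \<subseteq> e} |u v.
                      u \<in> verts H \<and> v \<in> verts H \<and> u \<noteq> v})"

definition random_subset :: "'v set \<Rightarrow> real \<Rightarrow> 'v set pmf" where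
  "random_subset V p =
     map_pmf (\<lambda>f. {v \<in> V. f v}) (Pi_pmf V False (\<lambda>_. bernoulli_pmf p))"

(* The law of the random induced subhypergraph; the random variable X of the theorem
   is num_edges under this law. *)
definition random_induced :: "'v hypergraph \<Rightarrow> real \<Rightarrow> 'v hypergraph pmf" where
  "random_induced H p = map_pmf (induced H) (random_subset (verts H) p)"

definition edge_mean :: "'v hypergraph \<Rightarrow> real \<Rightarrow> real" where
  "edge_mean H p = measure_pmf.expectation (random_induced H p) (\<lambda>G. real (num_edges G))"

definition edge_variance :: "'v hypergraph \<Rightarrow> real \<Rightarrow> real" where
  "edge_variance H p = measure_pmf.variance (random_induced H p) (\<lambda>G. real (num_edges G))"

definition Lambda :: "nat \<Rightarrow> nat \<Rightarrow> 'v hypergraph \<Rightarrow> real \<Rightarrow> real" where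
  "Lambda k n H p = edge_mean H p * (1 + real n * p ^ (k - 1))"

definition has_dense_subset :: "'v hypergraph \<Rightarrow> real \<Rightarrow> real \<Rightarrow> bool" where
  "has_dense_subset H D x \<longleftrightarrow>
     (\<exists>W \<subseteq> verts H. real (card W) \<le> D * max (sqrt x) 1 \<and>
                    real (num_edges (induced H W)) \<ge> x)"

end

theory Submission
  imports Defs
begin

text \<open>
  Plant a dense set \<open>W\<close>: with probability \<open>p\<close> to the power \<open>|W|\<close>, where \<open>|W| = O(sqrt t)\<close>, all of
  \<open>W\<close> is selected. If \<open>W\<close> contains \<open>\<mu> + t\<close> edges, this suffices. Otherwise its \<open>lam * t\<close> edges raise the
  mean by at least \<open>\<alpha> * lam * t\<close>, whereas the number \<open>Y\<close> of edges not inside \<open>W\<close> can only increase when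
  \<open>W\<close> is added to the random set, and it lies below its unconditional mean by less than a multiple of
  \<open>t\<close> with probability at least \<open>3 / 4\<close>. The latter is Chebyshev's inequality: since the indicators of
  two edges being selected are nonnegatively correlated, \<open>Var Y \<le> Var X\<close>, and the codegree condition
  gives \<open>Var X = O(\<Lambda>)\<close>, so that \<open>Var Y = O(t\<^sup>2)\<close> whichever term attains the minimum in the assumption on
  \<open>t\<close>.
\<close>

section \<open>The binomial random subset and forced inclusion of a set\<close>

lemma set_random_subset: "finite V \<Longrightarrow> set_pmf (random_subset V p) \<subseteq> Pow V"
  by (auto simp: random_subset_def)

lemma finite_set_random_subset: "finite V \<Longrightarrow> finite (set_pmf (random_subset V p))"
  using set_random_subset by (rule finite_subset) simp_all

lemma prob_random_subset_superset:
  assumes "finite V" "W \<subseteq> V" "0 \<le> p" "p \<le> 1"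
  shows "measure_pmf.prob (random_subset V p) {S. W \<subseteq> S} = p ^ card W"
proof -
  define B where "B = (\<lambda>v. if v \<in> W then {True} else UNIV)"
  have "measure_pmf.prob (random_subset V p) {S. W \<subseteq> S} =
          measure_pmf.prob (Pi_pmf V False (\<lambda>_. bernoulli_pmf p)) (Pi V B)"
    using assms(2) by (auto simp: random_subset_def B_def Pi_def intro!: arg_cong2[where f = measure])
  also have "\<dots> = (\<Prod>v\<in>V. measure_pmf.prob (bernoulli_pmf p) (B v))"
    using assms by (simp add: measure_Pi_pmf_Pi)
  also have "\<dots> = (\<Prod>v\<in>V. if v \<in> W then p else 1)"
    using assms by (intro prod.cong) (auto simp: B_def measure_pmf_single)
  also have "\<dots> = p ^ card W"
    using assms by (simp add: prod.If_cases Int_absorb1)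
  finally show ?thesis .
qed

text \<open>Independence of the selections made on disjoint sets; this splits a set to be planted
  from the remaining vertices.\<close>

lemma random_subset_union:
  assumes "finite V" "finite W" "V \<inter> W = {}"
  shows "random_subset (V \<union> W) p =
           map_pmf (\<lambda>(S, T). S \<union> T) (pair_pmf (random_subset V p) (random_subset W p))"
  using assms
  by (auto simp: random_subset_def Pi_pmf_union map_pmf_comp pair_map_pmf1 pair_map_pmf2
        case_prod_unfold intro!: map_pmf_cong)

text \<open>A case of Harris's inequality that needs only independence: adding \<open>W\<close> to
  the random set preserves \<open>A\<close>, and whether \<open>A\<close> then holds is decided by
  the selection outside \<open>W\<close>, which is independent of the selection inside.\<close>

lemma prob_superset_and_increasing_ge:
  fixes A :: "'a set \<Rightarrow> bool"
  assumes "finite V" "W \<subseteq> V" "0 \<le> p" "p \<le> 1" and mono: "\<And>S T. S \<subseteq> T \<Longrightarrow> A S \<Longrightarrow> A T"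
  shows "measure_pmf.prob (random_subset V p) {S. W \<subseteq> S \<and> A S}
           \<ge> p ^ card W * measure_pmf.prob (random_subset V p) {S. A S}"
proof -
  define P where "P = random_subset W p"
  define R where "R = random_subset (V - W) p"
  \<comment> \<open>Intersecting with the support makes \<open>T0\<close> countable, as the product
    rule for \<open>pair_pmf\<close> requires.\<close>
  define T0 where "T0 = {T. A (W \<union> T)} \<inter> set_pmf R"
  have finW: "finite W" using assms finite_subset by blast
  have V: "random_subset V p = map_pmf (\<lambda>(S, T). S \<union> T) (pair_pmf P R)"
    using random_subset_union[of W "V - W" p] assms finW by (simp add: P_def R_def Un_absorb1)
  have P: "measure_pmf.prob P {W} = p ^ card W"
  proof -
    have "measure_pmf.prob P {W} = measure_pmf.prob P {S. W \<subseteq> S}"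
      using set_random_subset[OF finW, of p]
      by (intro measure_pmf.finite_measure_eq_AE) (auto simp: P_def AE_measure_pmf_iff)
    then show ?thesis
      using prob_random_subset_superset[of W W p] finW assms by (simp add: P_def)
  qed
  have "measure_pmf.prob (random_subset V p) {S. A S}
          = measure_pmf.prob (pair_pmf P R) {(S, T). A (S \<union> T)}"
    by (simp add: V vimage_def case_prod_unfold)
  \<comment> \<open>On the support of \<open>P\<close>, \<open>S\<close> is a subset of
    \<open>W\<close>, so monotonicity turns \<open>A (S \<union> T)\<close> into
    \<open>A (W \<union> T)\<close>.\<close>
  also have "\<dots> \<le> measure_pmf.prob (pair_pmf P R) (snd -` T0)"
    using set_random_subset[OF finW, of p]
    by (intro measure_pmf.finite_measure_mono_AE)
       (auto simp: P_def AE_measure_pmf_iff T0_def elim!: mono[rotated])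
  also have "\<dots> = measure_pmf.prob R T0"
    by (metis map_snd_pair_pmf measure_map_pmf)
  finally have "p ^ card W * measure_pmf.prob (random_subset V p) {S. A S}
      \<le> measure_pmf.prob P {W} * measure_pmf.prob R T0"
    using assms by (simp add: P mult_left_mono)
  also have "\<dots> = measure_pmf.prob (pair_pmf P R) ({W} \<times> T0)"
    by (subst measure_pmf_prob_product) (auto simp: T0_def intro: countable_Int2)
  also have "\<dots> \<le> measure_pmf.prob (pair_pmf P R) {(S, T). W \<subseteq> S \<union> T \<and> A (S \<union> T)}"
    by (intro measure_pmf.finite_measure_mono) (auto simp: T0_def)
  also have "\<dots> = measure_pmf.prob (random_subset V p) {S. W \<subseteq> S \<and> A S}"
    by (simp add: V vimage_def case_prod_unfold)
  finally show ?thesis .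
qed

section \<open>Mean and variance of the number of selected sets\<close>

text \<open>The argument is a family of sets instead of a hypergraph, so that it can also be the
  edges not inside a planted set.\<close>

definition count_in :: "'v set set \<Rightarrow> 'v set \<Rightarrow> real" where
  "count_in F S = real (card {e \<in> F. e \<subseteq> S})"

lemma count_in_eq_sum: "finite F \<Longrightarrow> count_in F S = (\<Sum>e\<in>F. indicator {S. e \<subseteq> S} S)"
  by (simp add: count_in_def indicator_def sum.If_cases Int_def)

lemma count_in_mono: "finite F \<Longrightarrow> S \<subseteq> T \<Longrightarrow> count_in F S \<le> count_in F T"
  unfolding count_in_def by (intro of_nat_mono card_mono) auto

lemma expectation_count_in:
  assumes "finite V" "F \<subseteq> Pow V" "0 \<le> p" "p \<le> 1"
  shows "measure_pmf.expectation (random_subset V p) (count_in F) = (\<Sum>e\<in>F. p ^ card e)"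
proof -
  have "finite F" using assms finite_subset by blast
  have "measure_pmf.expectation (random_subset V p) (count_in F)
     = (\<Sum>e\<in>F. measure_pmf.expectation (random_subset V p) (indicator {S. e \<subseteq> S}))"
    unfolding count_in_eq_sum[OF \<open>finite F\<close>, abs_def]
    by (intro Bochner_Integration.integral_sum integrable_measure_pmf_finite
        finite_set_random_subset assms)
  also have "\<dots> = (\<Sum>e\<in>F. p ^ card e)"
    using assms by (intro sum.cong) (auto simp: prob_random_subset_superset)
  finally show ?thesis .
qed

text \<open>Each summand is the covariance of two indicators: \<open>e\<close> and \<open>f\<close>
  both lie in the random set exactly when their union does.\<close>

lemma variance_count_in:
  assumes "finite V" "F \<subseteq> Pow V" "0 \<le> p" "p \<le> 1"
  shows "measure_pmf.variance (random_subset V p) (count_in F)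
           = (\<Sum>e\<in>F. \<Sum>f\<in>F. p ^ card (e \<union> f) - p ^ (card e + card f))"
proof -
  have fin: "finite F" using assms finite_subset by blast
  have int: "integrable (measure_pmf (random_subset V p)) g" for g :: "'a set \<Rightarrow> real"
    by (intro integrable_measure_pmf_finite finite_set_random_subset assms)
  have "measure_pmf.expectation (random_subset V p) (\<lambda>S. (count_in F S)\<^sup>2)
     = measure_pmf.expectation (random_subset V p)
        (\<lambda>S. \<Sum>e\<in>F. \<Sum>f\<in>F. indicator {S. e \<union> f \<subseteq> S} S)"
    unfolding count_in_eq_sum[OF fin] power2_eq_square sum_product
    by (intro Bochner_Integration.integral_cong sum.cong) (auto simp: indicator_def)
  also have "\<dots> = (\<Sum>e\<in>F. \<Sum>f\<in>F. measure_pmf.expectation (random_subset V p)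
        (indicator {S. e \<union> f \<subseteq> S}))"
    by (simp only: Bochner_Integration.integral_sum int)
  also have "\<dots> = (\<Sum>e\<in>F. \<Sum>f\<in>F. p ^ card (e \<union> f))"
  proof (intro sum.cong refl)
    fix e f assume "e \<in> F" "f \<in> F"
    then have "e \<union> f \<subseteq> V" using assms by auto
    then show "measure_pmf.expectation (random_subset V p) (indicator {S. e \<union> f \<subseteq> S})
        = p ^ card (e \<union> f)"
      using prob_random_subset_superset[of V "e \<union> f" p] assms by simp
  qed
  finally have "measure_pmf.expectation (random_subset V p) (\<lambda>S. (count_in F S)\<^sup>2)
     = (\<Sum>e\<in>F. \<Sum>f\<in>F. p ^ card (e \<union> f))" .
  then show ?thesis
    using assms
    by (subst measure_pmf.variance_eq)
      (simp_all add: int expectation_count_in power2_eq_square[of "sum _ _"] sum_product power_add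
        sum_subtractf)
qed

lemma covariance_nonneg:
  fixes p :: real
  assumes "0 \<le> p" "p \<le> 1"
  shows "0 \<le> p ^ card (e \<union> f) - p ^ (card e + card f)"
  using power_decreasing[OF card_Un_le[of e f] assms] by simp

text \<open>Passing to a subfamily only drops covariances, all of which are nonnegative.\<close>

lemma variance_count_in_mono:
  assumes "finite V" "F \<subseteq> Pow V" "0 \<le> p" "p \<le> 1" "F' \<subseteq> F"
  shows "measure_pmf.variance (random_subset V p) (count_in F')
          \<le> measure_pmf.variance (random_subset V p) (count_in F)"
proof -
  have fin: "finite F" using assms finite_subset by blast
  have *: "F' \<subseteq> Pow V" using assms by auto
  have "(\<Sum>e\<in>F'. \<Sum>f\<in>F'. p ^ card (e \<union> f) - p ^ (card e + card f))
      \<le> (\<Sum>e\<in>F'. \<Sum>f\<in>F. p ^ card (e \<union> f) - p ^ (card e + card f))"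
    by (intro sum_mono sum_mono2 fin covariance_nonneg assms)
  also have "\<dots> \<le> (\<Sum>e\<in>F. \<Sum>f\<in>F. p ^ card (e \<union> f) - p ^ (card e + card f))"
    by (intro sum_mono2 sum_nonneg fin covariance_nonneg assms)
  finally show ?thesis
    using assms * by (simp only: variance_count_in)
qed

text \<open>The right-hand side consists of the diagonal terms \<open>f = e\<close> of the
  covariance sum; the others are nonnegative.\<close>

lemma variance_count_in_ge:
  assumes "finite V" "F \<subseteq> Pow V" "0 \<le> p" "p \<le> 1"
  shows "measure_pmf.variance (random_subset V p) (count_in F)
          \<ge> (\<Sum>e\<in>F. p ^ card e * (1 - p ^ card e))"
proof -
  have fin: "finite F" using assms finite_subset by blast
  have "p ^ card e * (1 - p ^ card e) \<le> (\<Sum>f\<in>F. p ^ card (e \<union> f) - p ^ (card e + card f))"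
    if "e \<in> F" for e
    using member_le_sum[OF that _ fin, of "\<lambda>f. p ^ card (e \<union> f) - p ^ (card e + card f)"] assms
      covariance_nonneg[of p e] by (simp add: algebra_simps power_add)
  then show ?thesis
    using assms by (simp add: variance_count_in sum_mono)
qed

text \<open>Chebyshev's inequality at distance \<open>2 * s\<close>, where \<open>s\<close> is any
  upper bound for the standard deviation: the failure probability is at most
  \<open>1 / 4\<close>.\<close>

lemma prob_count_in_gt:
  assumes "finite V" "F \<subseteq> Pow V" "0 \<le> p" "p \<le> 1" "s > 0"
    and "measure_pmf.variance (random_subset V p) (count_in F) \<le> s\<^sup>2"
  shows "measure_pmf.prob (random_subset V p) {S. count_in F S \<ge> (\<Sum>e\<in>F. p ^ card e) - 2 * s} \<ge> 3 / 4"
proof -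
  let ?M = "random_subset V p"
  let ?m = "\<Sum>e\<in>F. p ^ card e"
  let ?B = "{S. 2 * s \<le> \<bar>count_in F S - ?m\<bar>}"
  have "measure_pmf.prob ?M ?B \<le> measure_pmf.variance ?M (count_in F) / (2 * s)\<^sup>2"
    using measure_pmf.Chebyshev_inequality[of "count_in F" ?M "2 * s"] assms
    by (simp add: expectation_count_in integrable_measure_pmf_finite finite_set_random_subset)
  also have "\<dots> \<le> s\<^sup>2 / (2 * s)\<^sup>2"
    by (intro divide_right_mono assms) simp
  also have "\<dots> = 1 / 4"
    using \<open>s > 0\<close> by (simp add: power2_eq_square)
  finally have "3 / 4 \<le> 1 - measure_pmf.prob ?M ?B" by simp
  also have "\<dots> = measure_pmf.prob ?M (- ?B)"
    using measure_pmf.prob_compl[of ?B ?M] by (simp add: Compl_eq_Diff_UNIV)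
  also have "\<dots> \<le> measure_pmf.prob ?M {S. count_in F S \<ge> ?m - 2 * s}"
    by (intro measure_pmf.finite_measure_mono) auto
  finally show ?thesis .
qed

section \<open>Mean and lower variance bound for uniform hypergraphs\<close>

lemma num_edges_induced: "real (num_edges (induced H W)) = count_in (edges H) W"
  by (simp add: num_edges_def induced_def count_in_def)

lemma uniform_hypergraphD:
  assumes "uniform_hypergraph k H"
  shows "finite (verts H)" "edges H \<subseteq> Pow (verts H)" "finite (edges H)"
    "e \<in> edges H \<Longrightarrow> card e = k" "e \<in> edges H \<Longrightarrow> finite e"
proof -
  show *: "finite (verts H)" "edges H \<subseteq> Pow (verts H)" "e \<in> edges H \<Longrightarrow> card e = k"
    using assms by (auto simp: uniform_hypergraph_def)
  show "finite (edges H)" using * finite_subset by blast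
  show "finite e" if "e \<in> edges H" using *(1) finite_subset[of e "verts H"] *(2) that by auto
qed

lemma edge_mean_eq:
  assumes "uniform_hypergraph k H" "0 \<le> p" "p \<le> 1"
  shows "edge_mean H p = (\<Sum>e\<in>edges H. p ^ card e)" "edge_mean H p = real (card (edges H)) * p ^ k"
proof -
  note H = uniform_hypergraphD[OF assms(1)]
  show *: "edge_mean H p = (\<Sum>e\<in>edges H. p ^ card e)"
    using expectation_count_in[OF H(1,2) assms(2,3)]
    by (simp add: edge_mean_def random_induced_def num_edges_induced)
  show "edge_mean H p = real (card (edges H)) * p ^ k"
    unfolding * using H(4) by simp
qed

lemma edge_variance_eq:
  "edge_variance H p = measure_pmf.variance (random_subset (verts H) p) (count_in (edges H))"
  by (simp add: edge_variance_def random_induced_def num_edges_induced)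

text \<open>Since \<open>p ^ k \<le> p \<le> 1 - \<alpha>\<close>, every diagonal term keeps at
  least the fraction \<alpha> of \<open>p ^ k\<close>. This serves to bound \<open>t\<close> away
  from 0.\<close>

lemma edge_variance_ge:
  assumes "uniform_hypergraph k H" "k \<ge> 1" "0 \<le> p" "p \<le> 1 - \<alpha>" "0 \<le> \<alpha>"
  shows "edge_variance H p \<ge> \<alpha> * edge_mean H p"
proof -
  note H = uniform_hypergraphD[OF assms(1)]
  have "p ^ k \<le> 1 - \<alpha>"
    using power_decreasing[of 1 k p] assms by simp
  then have "\<alpha> * (\<Sum>e\<in>edges H. p ^ card e) \<le> (\<Sum>e\<in>edges H. p ^ card e * (1 - p ^ card e))"
    unfolding sum_distrib_left using assms H(4)
    by (intro sum_mono) (auto intro!: mult_left_mono simp: mult.commute[of \<alpha>])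
  also have "\<dots> \<le> edge_variance H p"
    unfolding edge_variance_eq using assms H by (intro variance_count_in_ge) auto
  finally show ?thesis
    using edge_mean_eq(1)[OF assms(1), of p] assms by simp
qed

section \<open>Degree counts and the upper variance bound\<close>

lemma codegree_le:
  assumes "finite (verts H)" "u \<in> verts H" "v \<in> verts H" "u \<noteq> v"
  shows "card {e \<in> edges H. u \<in> e \<and> v \<in> e} \<le> max_pair_degree H"
proof -
  let ?A = "{card {e \<in> edges H. {u, v} \<subseteq> e} |u v. u \<in> verts H \<and> v \<in> verts H \<and> u \<noteq> v}"
  have "?A \<subseteq> (\<lambda>(u, v). card {e \<in> edges H. {u, v} \<subseteq> e}) ` (verts H \<times> verts H)"
    by auto
  then have "finite ?A"
    using assms(1) by (meson finite_SigmaI finite_imageI finite_subset)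
  then show ?thesis
    unfolding max_pair_degree_def using assms by (intro Max_ge) auto
qed

text \<open>As \<open>k \<ge> 2\<close>, an edge through \<open>v\<close> has a second vertex
  \<open>u\<close>; the codegrees of \<open>u\<close> and \<open>v\<close> are summed over all
  \<open>u\<close>.\<close>

lemma degree_le:
  assumes "uniform_hypergraph k H" "k \<ge> 2" "v \<in> verts H"
  shows "card {e \<in> edges H. v \<in> e} \<le> num_verts H * max_pair_degree H"
proof -
  note H = uniform_hypergraphD[OF assms(1)]
  have "{e \<in> edges H. v \<in> e} \<subseteq> (\<Union>u\<in>verts H - {v}. {e \<in> edges H. u \<in> e \<and> v \<in> e})"
  proof
    fix e assume e: "e \<in> {e \<in> edges H. v \<in> e}"
    have "\<not> e \<subseteq> {v}"
      using card_mono[of "{v}" e] H(4)[of e] e assms(2) by auto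
    then show "e \<in> (\<Union>u\<in>verts H - {v}. {e \<in> edges H. u \<in> e \<and> v \<in> e})"
      using e H(2) by auto
  qed
  then have "card {e \<in> edges H. v \<in> e} \<le> card (\<Union>u\<in>verts H - {v}. {e \<in> edges H. u \<in> e \<and> v \<in> e})"
    using H by (intro card_mono) auto
  also have "\<dots> \<le> (\<Sum>u\<in>verts H - {v}. card {e \<in> edges H. u \<in> e \<and> v \<in> e})"
    using H by (intro card_UN_le) auto
  also have "\<dots> \<le> card (verts H - {v}) * max_pair_degree H"
    using codegree_le[OF H(1)] assms by (intro sum_bounded_above[THEN order_trans]) auto
  also have "\<dots> \<le> num_verts H * max_pair_degree H"
    unfolding num_verts_def using H by (intro mult_right_mono card_mono) auto
  finally show ?thesis .
qed

lemma card_edges_meeting_le: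
  assumes "uniform_hypergraph k H" "k \<ge> 2" "e \<in> edges H"
  shows "card {f \<in> edges H. e \<inter> f \<noteq> {}} \<le> k * (num_verts H * max_pair_degree H)"
proof -
  note H = uniform_hypergraphD[OF assms(1)]
  have fe: "finite e" and ev: "e \<subseteq> verts H" using H assms by auto
  have "{f \<in> edges H. e \<inter> f \<noteq> {}} = (\<Union>v\<in>e. {f \<in> edges H. v \<in> f})" by auto
  then have "card {f \<in> edges H. e \<inter> f \<noteq> {}} \<le> (\<Sum>v\<in>e. card {f \<in> edges H. v \<in> f})"
    using card_UN_le[OF fe] by simp
  also have "\<dots> \<le> card e * (num_verts H * max_pair_degree H)"
    using degree_le[OF assms(1,2)] ev by (intro sum_bounded_above[THEN order_trans]) auto
  finally show ?thesis using H(4) assms by simp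
qed

text \<open>Such an edge \<open>f\<close> contains one of the at most \<open>k\<^sup>2\<close>
  ordered pairs of distinct vertices of \<open>e\<close>, and each pair lies in a bounded number of
  edges.\<close>

lemma card_edges_meeting_twice_le:
  assumes "uniform_hypergraph k H" "e \<in> edges H"
  shows "card {f \<in> edges H. 2 \<le> card (e \<inter> f)} \<le> k\<^sup>2 * max_pair_degree H"
proof -
  note H = uniform_hypergraphD[OF assms(1)]
  have fe: "finite e" and ev: "e \<subseteq> verts H" using H assms by auto
  define P where "P = {(u, v). u \<in> e \<and> v \<in> e \<and> u \<noteq> v}"
  have P: "P \<subseteq> e \<times> e" by (auto simp: P_def)
  have fP: "finite P" using P fe finite_subset by blast
  have "{f \<in> edges H. 2 \<le> card (e \<inter> f)} \<subseteq> (\<Union>(u, v)\<in>P. {f \<in> edges H. u \<in> f \<and> v \<in> f})"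
  proof
    fix f assume f: "f \<in> {f \<in> edges H. 2 \<le> card (e \<inter> f)}"
    then have "2 \<le> card (e \<inter> f)" by simp
    then obtain T where "T \<subseteq> e \<inter> f" "card T = 2"
      by (meson obtain_subset_with_card_n)
    then show "f \<in> (\<Union>(u, v)\<in>P. {f \<in> edges H. u \<in> f \<and> v \<in> f})"
      using f by (auto simp: card_2_iff P_def)
  qed
  then have "card {f \<in> edges H. 2 \<le> card (e \<inter> f)}
      \<le> card (\<Union>(u, v)\<in>P. {f \<in> edges H. u \<in> f \<and> v \<in> f})"
    using H fP by (intro card_mono) auto
  also have "\<dots> \<le> (\<Sum>x\<in>P. card (case x of (u, v) \<Rightarrow> {f \<in> edges H. u \<in> f \<and> v \<in> f}))"
    using fP by (intro card_UN_le) auto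
  also have "\<dots> \<le> card P * max_pair_degree H"
    using codegree_le[OF H(1)] ev by (intro sum_bounded_above[THEN order_trans]) (auto simp: P_def)
  also have "\<dots> \<le> k\<^sup>2 * max_pair_degree H"
    using card_mono[OF _ P] fe H(4) assms
    by (intro mult_right_mono) (auto simp: card_cartesian_product power2_eq_square)
  finally show ?thesis .
qed

text \<open>Disjoint edges have covariance 0. If they share one vertex, their union has
  \<open>k + (k - 1)\<close> elements; if they share more, it still has at least \<open>k\<close>.
  The two terms lead to the two summands of \<open>Lambda\<close>.\<close>

lemma covariance_le:
  fixes p :: real
  assumes "finite e" "finite f" "card e = k" "card f = k" "0 \<le> p" "p \<le> 1"
  shows "p ^ card (e \<union> f) - p ^ (card e + card f)
    \<le> of_bool (2 \<le> card (e \<inter> f)) * p ^ k + of_bool (e \<inter> f \<noteq> {}) * p ^ (k + (k - 1))"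
proof -
  have c: "card (e \<union> f) + card (e \<inter> f) = 2 * k"
    using card_Un_Int[OF assms(1,2)] assms by simp
  have nn: "p ^ i \<ge> 0" for i using assms by simp
  consider "e \<inter> f = {}" | "card (e \<inter> f) = 1" | "2 \<le> card (e \<inter> f)"
    using assms(1) by (cases "card (e \<inter> f)") (auto simp: le_Suc_eq, linarith)
  then show ?thesis
  proof cases
    case 1
    then show ?thesis using c assms by (simp add: mult_2)
  next
    case 2
    then have "card (e \<union> f) = k + (k - 1)" "e \<inter> f \<noteq> {}" using c by auto
    then show ?thesis using 2 nn by simp
  next
    case 3
    have "k \<le> card (e \<union> f)" using assms card_mono[of "e \<union> f" e] by auto
    then have "p ^ card (e \<union> f) \<le> p ^ k" using assms by (intro power_decreasing)
    moreover have "e \<inter> f \<noteq> {}" using 3 by auto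
    ultimately show ?thesis using 3 nn[of "card e + card f"] nn[of "k + (k - 1)"] by simp
  qed
qed

text \<open>For a fixed edge, the pair degree bounds the number of edges meeting it twice by a
  constant and the number meeting it at all by a constant times \<open>n\<close>. Summing the
  covariance bounds over all edges then produces \<open>Lambda\<close>.\<close>

lemma edge_variance_le:
  assumes "uniform_hypergraph k H" "k \<ge> 2" "D \<ge> 1" "0 \<le> p" "p \<le> 1"
    "real (num_verts H) \<le> D * real n" "real (max_pair_degree H) \<le> D"
  shows "edge_variance H p \<le> (real k * D)\<^sup>2 * Lambda k n H p"
proof -
  note H = uniform_hypergraphD[OF assms(1)]
  let ?K = "(real k * D)\<^sup>2"
  have *: "(\<Sum>f\<in>edges H. p ^ card (e \<union> f) - p ^ (card e + card f))
      \<le> ?K * (p ^ k * (1 + real n * p ^ (k - 1)))" if e: "e \<in> edges H" for e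
  proof -
    have "(\<Sum>f\<in>edges H. p ^ card (e \<union> f) - p ^ (card e + card f))
      \<le> (\<Sum>f\<in>edges H. of_bool (2 \<le> card (e \<inter> f)) * p ^ k
            + of_bool (e \<inter> f \<noteq> {}) * p ^ (k + (k - 1)))"
      using e H assms by (intro sum_mono covariance_le) auto
    also have "\<dots> = real (card {f \<in> edges H. 2 \<le> card (e \<inter> f)}) * p ^ k
        + real (card {f \<in> edges H. e \<inter> f \<noteq> {}}) * p ^ (k + (k - 1))"
      using H(3) by (simp add: sum.distrib flip: sum_distrib_right) (simp add: Int_def)
    also have "\<dots> \<le> ?K * p ^ k + (?K * n) * p ^ (k + (k - 1))"
    proof (intro add_mono mult_right_mono)
      have "real (card {f \<in> edges H. 2 \<le> card (e \<inter> f)}) \<le> (real k)\<^sup>2 * real (max_pair_degree H)"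
        using of_nat_mono[OF card_edges_meeting_twice_le[OF assms(1) e], where 'a = real] by simp
      \<comment> \<open>\<open>D \<ge> 1\<close> allows replacing \<open>D\<close> by its square, so
        that both counts share the constant \<open>?K\<close>; below, \<open>k\<close> is squared
        for the same reason.\<close>
      also have "\<dots> \<le> (real k)\<^sup>2 * D\<^sup>2"
        using assms self_le_power[of D 2] by (intro mult_left_mono) auto
      finally show "real (card {f \<in> edges H. 2 \<le> card (e \<inter> f)}) \<le> ?K"
        by (simp add: power_mult_distrib)
      have "real (card {f \<in> edges H. e \<inter> f \<noteq> {}})
          \<le> real k * (real (num_verts H) * real (max_pair_degree H))"
        using of_nat_mono[OF card_edges_meeting_le[OF assms(1,2) e], where 'a = real] by simp
      also have "\<dots> \<le> (real k)\<^sup>2 * ((D * real n) * D)"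
        using assms self_le_power[of "real k" 2] by (intro mult_mono) auto
      finally show "real (card {f \<in> edges H. e \<inter> f \<noteq> {}}) \<le> ?K * real n"
        by (simp add: power2_eq_square algebra_simps)
    qed (use assms in auto)
    finally show ?thesis by (simp add: algebra_simps power_add)
  qed
  have "edge_variance H p = (\<Sum>e\<in>edges H. \<Sum>f\<in>edges H. p ^ card (e \<union> f) - p ^ (card e + card f))"
    unfolding edge_variance_eq using H assms by (intro variance_count_in) auto
  also have "\<dots> \<le> (\<Sum>e\<in>edges H. ?K * (p ^ k * (1 + real n * p ^ (k - 1))))"
    by (intro sum_mono *)
  also have "\<dots> = ?K * Lambda k n H p"
    using edge_mean_eq(2)[OF assms(1,4,5)] by (simp add: Lambda_def)
  finally show ?thesis .
qed

section \<open>Lower bounds for the upper tail\<close>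

text \<open>Selecting all of \<open>W\<close> makes the edges inside it exceed their mean by at
  least \<alpha> times their number. This gain pays for the deviation \<open>t\<close> and for the
  \<open>2 * s\<close> by which the remaining edges may fall below their mean in Chebyshev's
  inequality.\<close>

lemma upper_tail_by_planting:
  assumes "uniform_hypergraph k H" "k \<ge> 1" "0 \<le> p" "p \<le> 1 - \<alpha>" "0 \<le> \<alpha>"
    and W: "W \<subseteq> verts H" "\<alpha> * count_in (edges H) W \<ge> t + 2 * s"
    and s: "s > 0" "edge_variance H p \<le> s\<^sup>2"
  shows "measure_pmf.prob (random_subset (verts H) p) {S. count_in (edges H) S \<ge> edge_mean H p + t}
           \<ge> 3 / 4 * p ^ card W"
proof -
  note H = uniform_hypergraphD[OF assms(1)]
  let ?M = "random_subset (verts H) p"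
  have p1: "p \<le> 1" using assms by simp
  \<comment> \<open>\<open>F\<close> includes the edges that meet \<open>W\<close> without lying
    inside it; planting can only increase the number of selected edges in \<open>F\<close>.\<close>
  define F where "F = {e \<in> edges H. \<not> e \<subseteq> W}"
  define G where "G = {e \<in> edges H. e \<subseteq> W}"
  have EFG: "edges H = F \<union> G" "F \<inter> G = {}" by (auto simp: F_def G_def)
  have fin: "finite F" "finite G" using H by (auto simp: F_def G_def)
  have FV: "F \<subseteq> Pow (verts H)" using H by (auto simp: F_def)
  define m where "m = (\<Sum>e\<in>F. p ^ card e)"
  have "measure_pmf.variance ?M (count_in F) \<le> s\<^sup>2"
    using variance_count_in_mono[OF H(1,2) assms(3) p1, of F] s(2)
    by (auto simp: edge_variance_eq F_def)
  then have 34: "measure_pmf.prob ?M {S. count_in F S \<ge> m - 2 * s} \<ge> 3 / 4"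
    unfolding m_def using prob_count_in_gt[OF H(1) FV assms(3) p1 s(1)] by simp
  have "p ^ k \<le> 1 - \<alpha>"
    using power_decreasing[of 1 k p] assms by simp
  then have "(\<Sum>e\<in>G. p ^ card e) \<le> of_nat (card G) * (1 - \<alpha>)"
    using H(4) by (intro sum_bounded_above) (auto simp: G_def)
  moreover have "edge_mean H p = m + (\<Sum>e\<in>G. p ^ card e)"
    using edge_mean_eq(1)[OF assms(1,3) p1] fin EFG by (simp add: m_def sum.union_disjoint)
  \<comment> \<open>Edges inside \<open>W\<close> account for at most \<open>1 - \<alpha>\<close>
    times their number in the mean.\<close>
  ultimately have "edge_mean H p \<le> m + (1 - \<alpha>) * count_in (edges H) W"
    by (simp add: count_in_def G_def mult.commute)
  then have mt: "edge_mean H p + t \<le> m - 2 * s + count_in (edges H) W"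
    using W(2) by (simp add: algebra_simps)
  have split: "count_in (edges H) S = count_in F S + count_in (edges H) W" if "W \<subseteq> S" for S
  proof -
    have "{e \<in> edges H. e \<subseteq> S} = {e \<in> F. e \<subseteq> S} \<union> {e \<in> edges H. e \<subseteq> W}"
      using that by (auto simp: F_def)
    moreover have "card ({e \<in> F. e \<subseteq> S} \<union> {e \<in> edges H. e \<subseteq> W})
        = card {e \<in> F. e \<subseteq> S} + card {e \<in> edges H. e \<subseteq> W}"
      using fin H(3) by (intro card_Un_disjoint) (auto simp: F_def)
    ultimately show ?thesis by (simp add: count_in_def)
  qed
  have "3 / 4 * p ^ card W \<le> p ^ card W * measure_pmf.prob ?M {S. count_in F S \<ge> m - 2 * s}"
    using 34 assms mult_left_mono[OF 34, of "p ^ card W"] by (simp add: mult.commute)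
  also have "\<dots> \<le> measure_pmf.prob ?M {S. W \<subseteq> S \<and> count_in F S \<ge> m - 2 * s}"
    by (rule prob_superset_and_increasing_ge[OF H(1) W(1) assms(3) p1])
       (meson count_in_mono fin(1) order_trans)
  also have "\<dots> \<le> measure_pmf.prob ?M {S. count_in (edges H) S \<ge> edge_mean H p + t}"
  proof (intro measure_pmf.finite_measure_mono subsetI)
    fix S assume "S \<in> {S. W \<subseteq> S \<and> count_in F S \<ge> m - 2 * s}"
    then show "S \<in> {S. count_in (edges H) S \<ge> edge_mean H p + t}"
      using mt split[of S] by simp
  qed simp
  finally show ?thesis .
qed

lemma upper_tail_by_dense_subset:
  assumes "uniform_hypergraph k H" "0 \<le> p" "p \<le> 1" "W \<subseteq> verts H" "count_in (edges H) W \<ge> x"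
  shows "measure_pmf.prob (random_subset (verts H) p) {S. count_in (edges H) S \<ge> x} \<ge> p ^ card W"
proof -
  note H = uniform_hypergraphD[OF assms(1)]
  have "p ^ card W = measure_pmf.prob (random_subset (verts H) p) {S. W \<subseteq> S}"
    using H assms by (simp add: prob_random_subset_superset)
  also have "\<dots> \<le> measure_pmf.prob (random_subset (verts H) p) {S. count_in (edges H) S \<ge> x}"
    using assms(5) count_in_mono[OF H(3)]
    by (intro measure_pmf.finite_measure_mono) (auto intro: order_trans)
  finally show ?thesis .
qed

section \<open>Choice of the constants and conclusion\<close>

theorem theorem4p2:
  fixes k :: nat and a D :: real
  assumes "k \<ge> 2" and "a > 0" and "D \<ge> 1"
  shows "\<exists>n0::nat. n0 > 0 \<and>
    (\<forall>\<alpha>::real. 0 < \<alpha> \<and> \<alpha> < 1 \<longrightarrow>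
      (\<exists>c lam :: real. c \<ge> 1 \<and> lam \<ge> 1 \<and>
        (\<forall>(n::nat) (H :: 'v hypergraph) (p::real) (t::real).
           n \<ge> n0 \<longrightarrow>
           uniform_hypergraph k H \<longrightarrow>
           real (num_verts H) \<le> D * real n \<longrightarrow>
           real (num_edges H) \<ge> a * (real n)\<^sup>2 \<longrightarrow>
           real (max_pair_degree H) \<le> D \<longrightarrow>
           0 < p \<longrightarrow> p \<le> 1 - \<alpha> \<longrightarrow>
           t \<ge> of_bool (edge_mean H p \<ge> 1 / 2) *
                 min (sqrt (edge_variance H p)) (sqrt (Lambda k n H p)) \<longrightarrow>
           has_dense_subset H D (min (lam * t) (edge_mean H p + t)) \<longrightarrow>
           edge_mean H p + t \<ge> 1 \<longrightarrow>
           measure_pmf.prob (random_induced H p)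
               {G. real (num_edges G) \<ge> edge_mean H p + t}
             \<ge> exp (- c * sqrt t * ln (1 / p)))))"
proof (intro exI[of _ "1::nat"] conjI allI impI, goal_cases)
  case (2 \<alpha>)
  define K where "K = real k * D"
  have K: "K \<ge> 1"
    unfolding K_def using mult_mono[of 1 "real k" 1 D] assms by simp
  \<comment> \<open>This value gives \<open>\<alpha> * (lam * t) = t + 2 * (K * t)\<close>, the gain
    required for planting with \<open>s = K * t\<close>; here \<open>K\<^sup>2\<close> is the
    constant in the upper variance bound.\<close>
  define lam where "lam = (1 + 2 * K) / \<alpha>"
  \<comment> \<open>The term with \<open>D\<close> bounds \<open>card W\<close> as a multiple of
    \<open>sqrt t\<close>, and \<open>2 / \<alpha>\<^sup>2\<close> absorbs the constant factor
    \<open>3 / 4\<close>.\<close>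
  define c where "c = 1 + D * (lam + 2 / \<alpha>) + 2 / \<alpha>\<^sup>2"
  have lam3: "lam \<ge> 3"
    using 2 K by (simp add: lam_def field_simps)
  have c1: "c \<ge> 1"
    using 2 assms lam3 by (simp add: c_def)
  have "exp (- c * sqrt t * ln (1 / p)) \<le>
      measure_pmf.prob (random_induced H p) {G. real (num_edges G) \<ge> edge_mean H p + t}"
    if H: "uniform_hypergraph k H" "real (num_verts H) \<le> D * real n"
      "real (max_pair_degree H) \<le> D"
    and p: "0 < p" "p \<le> 1 - \<alpha>"
    and t: "t \<ge> of_bool (edge_mean H p \<ge> 1 / 2) *
                 min (sqrt (edge_variance H p)) (sqrt (Lambda k n H p))"
    and dense: "has_dense_subset H D (min (lam * t) (edge_mean H p + t))"
    and ge1: "edge_mean H p + t \<ge> 1"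
    for n p t and H :: "'v hypergraph"
  proof -
    let ?\<mu> = "edge_mean H p"
    have p1: "p \<le> 1" and k1: "k \<ge> 1" using p 2 assms by auto
    have mu0: "?\<mu> \<ge> 0" using edge_mean_eq(2)[OF H(1), of p] p p1 by simp
    have Lam: "Lambda k n H p \<ge> ?\<mu>"
      unfolding Lambda_def using mu0 p by (simp add: algebra_simps)
    have var: "edge_variance H p \<ge> \<alpha> * ?\<mu>"
      using edge_variance_ge[OF H(1) k1] p 2 by simp
    have half: "(\<alpha> / 2)\<^sup>2 \<le> \<alpha> / 2"
      using 2 power_decreasing[of 1 2 "\<alpha> / 2"] by simp
    \<comment> \<open>This lower bound lets constants be absorbed into multiples of
      \<open>sqrt t\<close>. For \<mu> at least 1/2 both terms of the minimum are at least
      \<open>\<alpha> / 2\<close>; otherwise \<open>\<mu> + t \<ge> 1\<close> forces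
      \<open>t > 1 / 2\<close>.\<close>
    have t_ge: "t \<ge> \<alpha> / 2"
    proof (cases "?\<mu> \<ge> 1 / 2")
      case True
      have "\<alpha> / 2 \<le> \<alpha> * ?\<mu>"
        using True 2 mult_left_mono[of "1 / 2" ?\<mu> \<alpha>] by simp
      then have "\<alpha> / 2 \<le> sqrt (edge_variance H p)"
        using half var by (intro real_le_rsqrt) linarith
      moreover have "\<alpha> / 2 \<le> sqrt (Lambda k n H p)"
        using half Lam True 2 by (intro real_le_rsqrt) linarith
      ultimately show ?thesis using t True by auto
    next
      case False
      then show ?thesis using ge1 2 by linarith
    qed
    have t0: "t > 0" using t_ge 2 by linarith
    have sqrt_t: "sqrt t \<ge> \<alpha> / 2"
      using half t_ge by (intro real_le_rsqrt) linarith
    obtain W where W: "W \<subseteq> verts H"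
        "real (card W) \<le> D * max (sqrt (min (lam * t) (?\<mu> + t))) 1"
        "count_in (edges H) W \<ge> min (lam * t) (?\<mu> + t)"
      using dense by (auto simp: has_dense_subset_def num_edges_induced)
    have tail: "3 / 4 * p ^ card W \<le> measure_pmf.prob (random_subset (verts H) p)
        {S. count_in (edges H) S \<ge> ?\<mu> + t}"
    \<comment> \<open>If the minimum is \<open>?\<mu> + t\<close>, the edges inside \<open>W\<close>
      suffice on their own; otherwise \<open>W\<close> has at least \<open>lam * t\<close> edges and
      planting applies.\<close>
    proof (cases "?\<mu> + t \<le> lam * t")
      case True
      then have "p ^ card W \<le> measure_pmf.prob (random_subset (verts H) p)
        {S. count_in (edges H) S \<ge> ?\<mu> + t}"
        using upper_tail_by_dense_subset[OF H(1), of p W "?\<mu> + t"] p p1 W by simp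
      then show ?thesis using zero_le_power[of p "card W"] p by linarith
    next
      case False
      \<comment> \<open>From \<open>?\<mu> + t > lam * t \<ge> 3 * t\<close> follows
        \<open>?\<mu> > 2 * t\<close>, so \<open>?\<mu> + t \<ge> 1\<close> gives
        \<open>?\<mu> > 2 / 3\<close>. Hence the indicator in the bound on \<open>t\<close> is
        1.\<close>
      have "?\<mu> \<ge> 1 / 2"
        using False ge1 t0 lam3 mult_right_mono[of 3 lam t] by linarith
      then have "min (sqrt (edge_variance H p)) (sqrt (Lambda k n H p)) \<le> t"
        using t by simp
      \<comment> \<open>Either alternative bounds the variance by \<open>(K * t)\<^sup>2\<close>:
        the first because \<open>K \<ge> 1\<close>, the second through the bound by
        \<open>Lambda\<close>.\<close>
      then have "edge_variance H p \<le> t\<^sup>2 \<or> Lambda k n H p \<le> t\<^sup>2"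
        using t0 by (auto simp: min_le_iff_disj dest: sqrt_le_D)
      moreover have "edge_variance H p \<le> K\<^sup>2 * Lambda k n H p"
        unfolding K_def by (rule edge_variance_le) (use H assms p p1 in auto)
      moreover have "t\<^sup>2 \<le> K\<^sup>2 * t\<^sup>2"
        using K mult_right_mono[of 1 "K\<^sup>2" "t\<^sup>2"] by (simp add: one_le_power)
      ultimately have "edge_variance H p \<le> (K * t)\<^sup>2"
        using mult_left_mono[of "Lambda k n H p" "t\<^sup>2" "K\<^sup>2"]
        by (auto simp: power_mult_distrib)
      moreover have "t + 2 * (K * t) \<le> \<alpha> * count_in (edges H) W"
      proof -
        have "t + 2 * (K * t) = \<alpha> * (lam * t)"
          using 2 by (simp add: lam_def) (simp add: algebra_simps)
        also have "\<dots> \<le> \<alpha> * count_in (edges H) W"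
          using W(3) False 2 by (intro mult_left_mono) auto
        finally show ?thesis .
      qed
      ultimately show ?thesis
        using upper_tail_by_planting[OF H(1) k1, of p \<alpha> W t "K * t"] p 2 W(1) K t0 by simp
    qed
    define L where "L = ln (1 / p)"
    \<comment> \<open>Since \<open>ln p \<le> p - 1 \<le> - \<alpha>\<close>. Together with
      \<open>sqrt t \<ge> \<alpha> / 2\<close> this makes \<open>sqrt t * L\<close> at least
      \<open>\<alpha>\<^sup>2 / 2\<close>.\<close>
    have "L \<ge> \<alpha>"
      using ln_le_minus_one[of p] p by (simp add: L_def ln_div)
    have pL: "p = exp (- L)" using p by (simp add: L_def ln_div)
    have L0: "L \<ge> 0" using \<open>L \<ge> \<alpha>\<close> 2 by linarith
    have "\<alpha> / 2 * \<alpha> \<le> sqrt t * L"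
      using sqrt_t \<open>L \<ge> \<alpha>\<close> 2 t0 by (intro mult_mono) auto
    then have one: "1 \<le> 2 / \<alpha>\<^sup>2 * (sqrt t * L)"
      using 2 by (simp add: field_simps power2_eq_square)
    have "sqrt (min (lam * t) (?\<mu> + t)) \<le> sqrt lam * sqrt t"
      by (simp flip: real_sqrt_mult)
    also have "\<dots> \<le> lam * sqrt t"
      using lam3 t0 by (intro mult_right_mono real_le_lsqrt) (auto simp: self_le_power)
    \<comment> \<open>The first summand dominates the square root, the second dominates 1 because
      \<open>sqrt t \<ge> \<alpha> / 2\<close>.\<close>
    finally have "max (sqrt (min (lam * t) (?\<mu> + t))) 1 \<le> lam * sqrt t + 2 / \<alpha> * sqrt t"
      using sqrt_t 2 lam3 t0 by (auto simp: field_simps intro: add_increasing add_increasing2)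
    then have "real (card W) \<le> D * (lam * sqrt t + 2 / \<alpha> * sqrt t)"
      using W(2) assms by (meson mult_left_mono order_trans zero_le_one)
    then have "real (card W) * L \<le> D * (lam * sqrt t + 2 / \<alpha> * sqrt t) * L"
      using L0 by (intro mult_right_mono)
    \<comment> \<open>The additional 1 in the exponent becomes the factor \<open>exp (- 1)\<close>,
      which is below the \<open>3 / 4\<close> lost in planting.\<close>
    then have "1 + real (card W) * L \<le> (c - 1) * sqrt t * L"
      using one by (simp add: c_def algebra_simps)
    also have "\<dots> \<le> c * sqrt t * L"
      using t0 L0 by (intro mult_right_mono) auto
    finally have "exp (- c * sqrt t * L) \<le> exp (- 1 - real (card W) * L)"
      by simp
    also have "\<dots> = exp (- 1) * p ^ card W"
      by (simp add: pL exp_diff exp_minus field_simps flip: exp_of_nat_mult)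
    also have "\<dots> \<le> 3 / 4 * p ^ card W"
    proof (intro mult_right_mono)
      show "exp (- 1) \<le> (3 / 4 :: real)"
        using exp_ge_add_one_self[of 1] by (simp add: exp_minus field_simps)
    qed (use p in auto)
    finally show ?thesis
      using tail by (simp add: L_def random_induced_def num_edges_induced)
  qed
  then show ?case
    using c1 lam3 by (intro exI[of _ c] exI[of _ lam]) auto
qed simp

end
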